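(* The enveloping algebra $\mathcal{U}(K_3)$ of the tiny Kaplansky algebra $K_3$ satisfies the Poincaré–Birkhoff–Witt property, i.e. $\mathrm{Gr}\,\mathcal{U}(K_3)\cong G(K_3)$ as graded algebras.
   Context: $\mathbb{K}=\mathbb{R}$ or $\mathbb{C}$ is the base field. $K_3$ is the 3-dimensional supercommutative superalgebra over $\mathbb K$ with basis $\varepsilon$ (even), $a,b$ (odd) and products $\varepsilon\varepsilon=\varepsilon$, $\varepsilon a=a\varepsilon=\frac12a$, $\varepsilon b=b\varepsilon=\frac12b$, $ab=-ba=\frac12\varepsilon$, $aa=bb=0$. For a $\mathbb{Z}_2$-graded algebra $\mathfrak{a}=\mathfrak{a}_0\oplus\mathfrak{a}_1$ of this kind (a Lie antialgebra), $\mathcal{U}(\mathfrak{a}):=\mathcal{T}(\mathfrak{a})/\langle\mathcal{P}\rangle$, where $\mathcal{T}(\mathfrak{a})=\bigoplus_{n\ge0}\mathfrak a^{\otimes n}$ is the tensor algebra and $\langle\mathcal{P}\rangle$ is the two-sided ideal generated by $\frac12(s\otimes t-t\otimes s)-st$, $\ \frac12(s\otimes x+x\otimes s)-sx$, $\ x\otimes y-xy$, for $s,t\in\mathfrak{a}_1$, $x,y\in\mathfrak{a}_0$. It is filtered by $\mathcal{U}_n$ = image of $\bigoplus_{0\le k\le n}\mathfrak{a}^{\otimes k}$, with $\mathcal U_{-1}=0$, and $\mathrm{Gr}\,\mathcal{U}:=\bigoplus_{n\ge0}\mathcal{U}_n/\mathcal{U}_{n-1}$. $G(\mathfrak{a}):=\mathcal{T}(\mathfrak{a})/\langle\mathcal{R}\rangle$,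 where $\mathcal{R}=\{s\otimes t-t\otimes s,\ s\otimes x+x\otimes s,\ x\otimes y : x,y\in\mathfrak{a}_0,\ s,t\in\mathfrak{a}_1\}$, graded by tensor degree. The PBW property for $\mathcal{U}(\mathfrak{a})$ means $\mathrm{Gr}\,\mathcal{U}(\mathfrak{a})\cong G(\mathfrak{a})$. *)

theory Defs
  imports Complex_Main "HOL-Algebra.QuotRing" "HOL-Algebra.Module" "HOL-Library.Poly_Mapping"
begin

section \<open>Superalgebras with a homogeneous basis\<close>

text \<open>
  A superalgebra over the field \<open>'k\<close> is given by a homogeneous basis \<open>'b\<close>: the underlying vector
  space consists of the finitely supported coordinate functions \<open>'b \<Rightarrow>\<^sub>0 'k\<close>, and \<open>bprod\<close> lists the
  products of the basis elements.
\<close>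

record (overloaded) ('b, 'k) superalgebra =
  is_odd :: "'b \<Rightarrow> bool"
  bprod :: "'b \<Rightarrow> 'b \<Rightarrow> ('b \<Rightarrow>\<^sub>0 'k)"

definition scale :: "'k::semiring_0 \<Rightarrow> ('b \<Rightarrow>\<^sub>0 'k) \<Rightarrow> ('b \<Rightarrow>\<^sub>0 'k)"
  where "scale c v = Poly_Mapping.map (\<lambda>d. c * d) v"

definition even_part :: "('b, 'k::zero) superalgebra \<Rightarrow> ('b \<Rightarrow>\<^sub>0 'k) set"
  where "even_part \<aa> = {v. \<forall>i \<in> Poly_Mapping.keys v. \<not> is_odd \<aa> i}"

definition odd_part :: "('b, 'k::zero) superalgebra \<Rightarrow> ('b \<Rightarrow>\<^sub>0 'k) set"
  where "odd_part \<aa> = {v. \<forall>i \<in> Poly_Mapping.keys v. is_odd \<aa> i}"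

definition sprod :: "('b, 'k::field) superalgebra \<Rightarrow> ('b \<Rightarrow>\<^sub>0 'k) \<Rightarrow> ('b \<Rightarrow>\<^sub>0 'k) \<Rightarrow> ('b \<Rightarrow>\<^sub>0 'k)"
  where "sprod \<aa> u v =
    (\<Sum>i \<in> Poly_Mapping.keys u. \<Sum>j \<in> Poly_Mapping.keys v.
       scale (Poly_Mapping.lookup u i * Poly_Mapping.lookup v j) (bprod \<aa> i j))"

section \<open>The algebra K3\<close>

datatype k3_basis = Eps | OddA | OddB

fun k3_odd :: "k3_basis \<Rightarrow> bool" where
  "k3_odd Eps = False"
| "k3_odd OddA = True"
| "k3_odd OddB = True"

fun k3_bprod :: "k3_basis \<Rightarrow> k3_basis \<Rightarrow> (k3_basis \<Rightarrow>\<^sub>0 'k::field)" where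
  "k3_bprod Eps Eps = Poly_Mapping.single Eps 1"
| "k3_bprod Eps OddA = Poly_Mapping.single OddA (1/2)"
| "k3_bprod OddA Eps = Poly_Mapping.single OddA (1/2)"
| "k3_bprod Eps OddB = Poly_Mapping.single OddB (1/2)"
| "k3_bprod OddB Eps = Poly_Mapping.single OddB (1/2)"
| "k3_bprod OddA OddB = Poly_Mapping.single Eps (1/2)"
| "k3_bprod OddB OddA = Poly_Mapping.single Eps (- (1/2))"
| "k3_bprod OddA OddA = 0"
| "k3_bprod OddB OddB = 0"

definition K3 :: "(k3_basis, 'k::field) superalgebra"
  where "K3 = \<lparr>is_odd = k3_odd, bprod = k3_bprod\<rparr>"

section \<open>The tensor algebra\<close>

text \<open>
  If \<open>V\<close> has basis \<open>'b\<close>, then the \<open>n\<close>-th tensor power of \<open>V\<close> has as basis the pure tensors of \<open>n\<close>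
  basis elements, i.e. the words of length \<open>n\<close> over \<open>'b\<close>.  The tensor algebra is thus the space of
  finitely supported coordinate functions on words; with concatenation as the monoid operation on
  words, the convolution product of \<open>\<Rightarrow>\<^sub>0\<close> is the tensor product.
\<close>

datatype 'b word = Word (letters: "'b list")

instantiation word :: (type) monoid_add
begin

definition zero_word :: "'a word" where "0 = Word []"

definition plus_word :: "'a word \<Rightarrow> 'a word \<Rightarrow> 'a word"
  where "v + w = Word (letters v @ letters w)"

instance by standard (simp_all add: zero_word_def plus_word_def)

end

type_synonym ('b, 'k) tensors = "'b word \<Rightarrow>\<^sub>0 'k"

definition incl :: "('b \<Rightarrow>\<^sub>0 'k::comm_monoid_add) \<Rightarrow> ('b, 'k) tensors"
  where "incl v = (\<Sum>i \<in> Poly_Mapping.keys v.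
    Poly_Mapping.single (Word [i]) (Poly_Mapping.lookup v i))"

text \<open>
  Associative unital \<open>'k\<close>-algebras are represented by the record type \<open>module\<close>, which extends rings
  by a scalar multiplication.
\<close>

definition tensor_algebra :: "('k::field, ('b, 'k) tensors) module"
  where "tensor_algebra =
    \<lparr>carrier = UNIV, mult = (*), one = 1, zero = 0, add = (+), smult = scale\<rparr>"

definition tensor_power :: "nat \<Rightarrow> ('b, 'k::zero) tensors set"
  where "tensor_power n = {p. \<forall>w \<in> Poly_Mapping.keys p. length (letters w) = n}"

text \<open>The index is an integer so that the filtration step of index -1 is the zero space.\<close>

definition tensors_upto :: "int \<Rightarrow> ('b, 'k::zero) tensors set"
  where "tensors_upto n = {p. \<forall>w \<in> Poly_Mapping.keys p. int (length (letters w)) \<le> n}"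

section \<open>Quotient algebras, graded isomorphisms and associated graded algebras\<close>

definition quotient_algebra ::
    "('k, 'a) module \<Rightarrow> 'a set \<Rightarrow> ('k, 'a set) module"
  where "quotient_algebra A I = ring.extend (A Quot I)
    (module.fields (\<lambda>c X. \<Union>x\<in>X. I +>\<^bsub>A\<^esub> (c \<odot>\<^bsub>A\<^esub> x)))"

definition graded_isomorphic ::
    "('k, 'a) module \<Rightarrow> (nat \<Rightarrow> 'a set) \<Rightarrow> ('k, 'b) module \<Rightarrow> (nat \<Rightarrow> 'b set) \<Rightarrow> bool"
  where "graded_isomorphic A Agr B Bgr \<longleftrightarrow>
    (\<exists>h \<in> ring_iso A B.
       (\<forall>c. \<forall>x \<in> carrier A. h (c \<odot>\<^bsub>A\<^esub> x) = c \<odot>\<^bsub>B\<^esub> h x) \<and>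
       (\<forall>n. h ` Agr n = Bgr n))"

text \<open>
  For an algebra \<open>A\<close> with an increasing filtration \<open>F\<close>, the degree \<open>n\<close> component of the associated
  graded algebra is the set of cosets of \<open>F (n - 1)\<close> in \<open>F n\<close>; its zero element is \<open>F (n - 1)\<close>.
  An element of the direct sum is the family of its components, almost all of them zero.
\<close>

definition gr_component :: "('k, 'a) module \<Rightarrow> (int \<Rightarrow> 'a set) \<Rightarrow> nat \<Rightarrow> 'a set set"
  where "gr_component A F n = (\<lambda>x. F (int n - 1) +>\<^bsub>A\<^esub> x) ` F (int n)"

text \<open>
  The product is induced by \<open>(x + F (i - 1)) (y + F (j - 1)) = x y + F (i + j - 1)\<close> for \<open>x\<close> in \<open>F i\<close>
  and \<open>y\<close> in \<open>F j\<close>.  As in \<^const>\<open>rcoset_mult\<close>, the union ranges over all choices \<open>u\<close>, \<open>v\<close> of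
  representatives, all of which give the same coset.
\<close>

definition assoc_graded ::
    "('k, 'a) module \<Rightarrow> (int \<Rightarrow> 'a set) \<Rightarrow> ('k, nat \<Rightarrow> 'a set) module"
  where "assoc_graded A F =
    \<lparr>carrier = {f. (\<forall>n. f n \<in> gr_component A F n) \<and> finite {n. f n \<noteq> F (int n - 1)}},
     mult = (\<lambda>f g n. \<Union>u \<in> {u. \<forall>i. u i \<in> f i}. \<Union>v \<in> {v. \<forall>j. v j \<in> g j}.
               F (int n - 1) +>\<^bsub>A\<^esub> (\<Oplus>\<^bsub>A\<^esub>i\<in>{..n}. u i \<otimes>\<^bsub>A\<^esub> v (n - i))),
     one = (\<lambda>n. if n = 0 then F (- 1) +>\<^bsub>A\<^esub> \<one>\<^bsub>A\<^esub> else F (int n - 1)),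
     zero = (\<lambda>n. F (int n - 1)),
     add = (\<lambda>f g n. f n <+>\<^bsub>A\<^esub> g n),
     smult = (\<lambda>c f n. \<Union>x \<in> f n. F (int n - 1) +>\<^bsub>A\<^esub> (c \<odot>\<^bsub>A\<^esub> x))\<rparr>"

definition assoc_graded_part ::
    "('k, 'a) module \<Rightarrow> (int \<Rightarrow> 'a set) \<Rightarrow> nat \<Rightarrow> (nat \<Rightarrow> 'a set) set"
  where "assoc_graded_part A F n =
    {f \<in> carrier (assoc_graded A F). \<forall>m. m \<noteq> n \<longrightarrow> f m = F (int m - 1)}"

section \<open>The enveloping algebra and the PBW property\<close>

definition env_relations :: "('b, 'k::field) superalgebra \<Rightarrow> ('b, 'k) tensors set"
  where "env_relations \<aa> =
      {scale (1/2) (incl s * incl t - incl t * incl s) - incl (sprod \<aa> s t) | s t.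
         s \<in> odd_part \<aa> \<and> t \<in> odd_part \<aa>}
    \<union> {scale (1/2) (incl s * incl x + incl x * incl s) - incl (sprod \<aa> s x) | s x.
         s \<in> odd_part \<aa> \<and> x \<in> even_part \<aa>}
    \<union> {incl x * incl y - incl (sprod \<aa> x y) | x y.
         x \<in> even_part \<aa> \<and> y \<in> even_part \<aa>}"

definition env_ideal :: "('b, 'k::field) superalgebra \<Rightarrow> ('b, 'k) tensors set"
  where "env_ideal \<aa> = Idl\<^bsub>tensor_algebra\<^esub> (env_relations \<aa>)"

definition env_algebra ::
    "('b, 'k::field) superalgebra \<Rightarrow> ('k, ('b, 'k) tensors set) module"
  where "env_algebra \<aa> = quotient_algebra tensor_algebra (env_ideal \<aa>)"

definition env_filtration ::
    "('b, 'k::field) superalgebra \<Rightarrow> int \<Rightarrow> ('b, 'k) tensors set set"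
  where "env_filtration \<aa> n =
    (\<lambda>p. env_ideal \<aa> +>\<^bsub>tensor_algebra\<^esub> p) ` tensors_upto n"

definition hom_relations :: "('b, 'k::field) superalgebra \<Rightarrow> ('b, 'k) tensors set"
  where "hom_relations \<aa> =
      {incl s * incl t - incl t * incl s | s t. s \<in> odd_part \<aa> \<and> t \<in> odd_part \<aa>}
    \<union> {incl s * incl x + incl x * incl s | s x. s \<in> odd_part \<aa> \<and> x \<in> even_part \<aa>}
    \<union> {incl x * incl y | x y. x \<in> even_part \<aa> \<and> y \<in> even_part \<aa>}"

definition hom_ideal :: "('b, 'k::field) superalgebra \<Rightarrow> ('b, 'k) tensors set"
  where "hom_ideal \<aa> = Idl\<^bsub>tensor_algebra\<^esub> (hom_relations \<aa>)"

definition G_algebra ::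
    "('b, 'k::field) superalgebra \<Rightarrow> ('k, ('b, 'k) tensors set) module"
  where "G_algebra \<aa> = quotient_algebra tensor_algebra (hom_ideal \<aa>)"

definition G_part ::
    "('b, 'k::field) superalgebra \<Rightarrow> nat \<Rightarrow> ('b, 'k) tensors set set"
  where "G_part \<aa> n = (\<lambda>p. hom_ideal \<aa> +>\<^bsub>tensor_algebra\<^esub> p) ` tensor_power n"

definition pbw_property :: "('b, 'k::field) superalgebra \<Rightarrow> bool"
  where "pbw_property \<aa> \<longleftrightarrow>
    graded_isomorphic
      (assoc_graded (env_algebra \<aa>) (env_filtration \<aa>))
      (assoc_graded_part (env_algebra \<aa>) (env_filtration \<aa>))
      (G_algebra \<aa>) (G_part \<aa>)"

section \<open>Basic facts\<close>

lemma sprod_single: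
  assumes "c \<noteq> 0" "d \<noteq> 0"
  shows "sprod \<aa> (Poly_Mapping.single i c) (Poly_Mapping.single j d) = scale (c * d) (bprod \<aa> i j)"
  using assms by (simp add: sprod_def)

lemma incl_single [simp]: "incl (Poly_Mapping.single i c) = Poly_Mapping.single (Word [i]) c"
  by (cases "c = 0") (simp_all add: incl_def)

lemma tensors_upto_negative: "n < 0 \<Longrightarrow> tensors_upto n = {0}"
  unfolding tensors_upto_def by (auto simp flip: keys_eq_empty)

lemma ring_tensor_algebra: "ring (tensor_algebra :: ('k::field, ('b, 'k) tensors) module)"
proof (rule ringI)
  show "abelian_group (tensor_algebra :: ('k, ('b, 'k) tensors) module)"
    by (rule abelian_groupI)
       (auto simp: tensor_algebra_def add.assoc add.commute intro: exI[of _ "- x" for x])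
  show "Group.monoid (tensor_algebra :: ('k, ('b, 'k) tensors) module)"
    by (rule monoidI) (auto simp: tensor_algebra_def mult.assoc)
qed (auto simp: tensor_algebra_def algebra_simps)

lemma ideal_env_ideal: "ideal (env_ideal \<aa>) tensor_algebra"
  unfolding env_ideal_def
  by (rule ring.genideal_ideal[OF ring_tensor_algebra]) (simp add: tensor_algebra_def)

lemma ideal_hom_ideal: "ideal (hom_ideal \<aa>) tensor_algebra"
  unfolding hom_ideal_def
  by (rule ring.genideal_ideal[OF ring_tensor_algebra]) (simp add: tensor_algebra_def)

lemma quotient_algebra_simps:
  "carrier (quotient_algebra A I) = carrier (A Quot I)"
  "mult (quotient_algebra A I) = mult (A Quot I)"
  "one (quotient_algebra A I) = one (A Quot I)"
  "zero (quotient_algebra A I) = zero (A Quot I)"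
  "add (quotient_algebra A I) = add (A Quot I)"
  "smult (quotient_algebra A I) = (\<lambda>c X. \<Union>x\<in>X. I +>\<^bsub>A\<^esub> (c \<odot>\<^bsub>A\<^esub> x))"
  by (simp_all add: quotient_algebra_def ring.defs module.defs)

end

theory Submission
  imports Defs
begin

text \<open>
  Write \<open>I\<close> and \<open>J\<close> for the enveloping and the homogeneous ideal.  Sending a tensor to the family of
  classes of its homogeneous components maps the tensor algebra onto \<open>Gr U\<close>, and the kernel consists
  of the tensors whose components are top components of elements of \<open>I\<close>.  It contains \<open>J\<close>, so PBW
  amounts to: the top component of every element of \<open>I\<close> lies in \<open>J\<close>.

  For K3 let the tensor algebra act on formal sums of the normal monomials \<open>a\<^sup>i b\<^sup>j\<close>, \<open>\<epsilon> a\<^sup>i b\<^sup>j\<close> by the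
  left multiplication that the enveloping relations force; one checks that \<open>I\<close> acts as zero.  Modulo
  \<open>J\<close>, a word of length \<open>n\<close> equals the degree \<open>n\<close> part of its action on \<open>1\<close>, hence so does the top
  component of a tensor of degree at most \<open>n\<close>.  For elements of \<open>I\<close> that action is zero.
\<close>

section \<open>Tensors and their homogeneous components\<close>

text \<open>A finitely supported function is the sum of its one-point parts, and
  \<open>single\<close> with \<open>c = 0\<close> covers the zero function. Bilinear identities on
  tensors thereby reduce to words.\<close>

lemma poly_mapping_additive_induct [case_names single add]:
  assumes single: "\<And>k c. P (Poly_Mapping.single k c)"
    and add: "\<And>f g. P f \<Longrightarrow> P g \<Longrightarrow> P (f + g)"
  shows "P (f :: 'a \<Rightarrow>\<^sub>0 'b::comm_monoid_add)"
proof -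
  have "P (\<Sum>k\<in>S. Poly_Mapping.single k (Poly_Mapping.lookup f k))" if "finite S" for S
    using that
  proof (induction S)
    case empty
    show ?case using single[of _ 0] by simp
  next
    case (insert k S)
    then show ?case by (simp add: single add)
  qed
  moreover have "(\<Sum>k\<in>Poly_Mapping.keys f. Poly_Mapping.single k (Poly_Mapping.lookup f k)) = f"
    by (rule poly_mapping_eqI)
       (auto simp: lookup_sum lookup_single when_def in_keys_iff)
  ultimately show ?thesis
    by (metis finite_keys)
qed

lemma lookup_scale [simp]: "Poly_Mapping.lookup (scale c v) i = c * Poly_Mapping.lookup v i"
  unfolding scale_def by (simp add: map.rep_eq when_def)

lemma scale_single [simp]:
  "scale c (Poly_Mapping.single i d) = Poly_Mapping.single i (c * d)"
  by (rule poly_mapping_eqI) (simp add: lookup_single when_def)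

lemma scale_add_right: "scale c (u + v) = scale c u + scale c v"
  by (rule poly_mapping_eqI) (simp add: lookup_add distrib_left)

lemma scale_zero_left [simp]: "scale 0 p = 0"
  by (rule poly_mapping_eqI) simp

lemma scale_zero_right [simp]: "scale c 0 = 0"
  by (rule poly_mapping_eqI) simp

lemma scale_add_left: "scale (c + d) p = scale c p + scale d p"
  by (rule poly_mapping_eqI) (simp add: lookup_add distrib_right)

lemma scale_diff_right: "scale c (p - q) = scale c p - scale c q"
  for p :: "'a \<Rightarrow>\<^sub>0 'k::ring"
  by (rule poly_mapping_eqI) (simp add: lookup_minus right_diff_distrib)

lemma scale_uminus_left: "scale (- c) p = - scale c p"
  for p :: "'a \<Rightarrow>\<^sub>0 'k::ring"
  by (rule poly_mapping_eqI) simp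

lemma scale_scale: "scale c (scale d p) = scale (c * d) p"
  by (rule poly_mapping_eqI) (simp add: mult.assoc)

lemma scale_sum: "scale c (sum f S) = (\<Sum>x\<in>S. scale c (f x))"
  by (induction S rule: infinite_finite_induct) (simp_all add: scale_add_right)

lemma mult_scale_right: "p * scale c q = scale c (p * q)"
  for p q :: "'a::monoid_add \<Rightarrow>\<^sub>0 'k::comm_semiring_0"
proof (induction p rule: poly_mapping_additive_induct)
  case (single v d)
  show ?case
    by (induction q rule: poly_mapping_additive_induct)
       (simp_all add: mult_single distrib_left scale_add_right mult.left_commute)
qed (simp add: distrib_right scale_add_right)

text \<open>Scalars sit in the tensor algebra as multiples of the empty word, so closure of an ideal
  under scalars follows from closure under products.\<close>

lemma scale_eq_mult: "scale c p = Poly_Mapping.single 0 c * p"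
  for p :: "'a::monoid_add \<Rightarrow>\<^sub>0 'k::semiring_0"
  by (induction p rule: poly_mapping_additive_induct)
     (simp_all add: mult_single scale_add_right distrib_left)

section \<open>Decomposition of tensors by word length\<close>

lift_definition component :: "nat \<Rightarrow> ('b, 'k::zero) tensors \<Rightarrow> ('b, 'k) tensors"
  is "\<lambda>n f w. if length (letters w) = n then f w else 0"
  by (erule rev_finite_subset) auto

lemma lookup_component:
  "Poly_Mapping.lookup (component n p) w =
    (if length (letters w) = n then Poly_Mapping.lookup p w else 0)"
  by transfer simp

lemma component_zero [simp]: "component n 0 = 0"
  by (rule poly_mapping_eqI) (simp add: lookup_component)

lemma component_add: "component n (p + q) = component n p + component n q"
  for p q :: "('b, 'k::monoid_add) tensors"
  by (rule poly_mapping_eqI) (simp add: lookup_component lookup_add)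

lemma component_diff: "component n (p - q) = component n p - component n q"
  for p q :: "('b, 'k::ab_group_add) tensors"
  by (rule poly_mapping_eqI) (simp add: lookup_component lookup_minus)

lemma component_scale: "component n (scale c p) = scale c (component n p)"
  by (rule poly_mapping_eqI) (simp add: lookup_component)

lemma component_sum: "component n (sum f S) = (\<Sum>x\<in>S. component n (f x))"
  for f :: "'a \<Rightarrow> ('b, 'k::comm_monoid_add) tensors"
  by (induction S rule: infinite_finite_induct) (simp_all add: component_add)

lemma component_single:
  "component n (Poly_Mapping.single w c) =
    (if length (letters w) = n then Poly_Mapping.single w c else 0)"
  by (rule poly_mapping_eqI) (simp add: lookup_component lookup_single when_def)

lemma component_component:
  "component m (component n p) = (if m = n then component n p else 0)"
  by (rule poly_mapping_eqI) (simp add: lookup_component)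

lemma letters_zero: "letters 0 = []"
  by (simp add: zero_word_def)

lemma length_letters_add: "length (letters (v + w)) = length (letters v) + length (letters w)"
  by (simp add: plus_word_def)

text \<open>For two words only the summand whose index is the length of the left word can survive;
  bilinearity does the rest.\<close>

lemma component_mult:
  "component n (p * q) = (\<Sum>i\<le>n. component i p * component (n - i) q)"
  for p q :: "('b, 'k::semiring_0) tensors"
proof (induction p rule: poly_mapping_additive_induct)
  case (single v c)
  show ?case
  proof (induction q rule: poly_mapping_additive_induct)
    case (single w d)
    have "(\<Sum>i\<le>n. component i (Poly_Mapping.single v c) * component (n - i) (Poly_Mapping.single w d))
        = (\<Sum>i\<le>n. if i = length (letters v) \<and> length (letters (v + w)) = n
             then Poly_Mapping.single (v + w) (c * d) else 0)"
      by (rule sum.cong) (auto simp: component_single mult_single length_letters_add)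
    also have "\<dots> = component n (Poly_Mapping.single v c * Poly_Mapping.single w d)"
      by (cases "length (letters (v + w)) = n")
         (auto simp: component_single mult_single length_letters_add)
    finally show ?case by simp
  next
    case (add f g)
    then show ?case by (simp add: component_add distrib_left sum.distrib)
  qed
next
  case (add f g)
  then show ?case by (simp add: component_add distrib_right sum.distrib)
qed

section \<open>The degree filtration of tensors\<close>

lemma tensors_upto_iff:
  "p \<in> tensors_upto n \<longleftrightarrow>
    (\<forall>w. Poly_Mapping.lookup p w \<noteq> 0 \<longrightarrow> int (length (letters w)) \<le> n)"
  by (simp add: tensors_upto_def Ball_def in_keys_iff)

lemma tensors_upto_zero [simp]: "0 \<in> tensors_upto n"
  by (simp add: tensors_upto_iff)

lemma tensors_upto_add:
  "p \<in> tensors_upto n \<Longrightarrow> q \<in> tensors_upto n \<Longrightarrow> p + q \<in> tensors_upto n"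
  for p q :: "('b, 'k::monoid_add) tensors"
  unfolding tensors_upto_iff lookup_add by (metis add_0)

lemma tensors_upto_diff:
  "p \<in> tensors_upto n \<Longrightarrow> q \<in> tensors_upto n \<Longrightarrow> p - q \<in> tensors_upto n"
  for p q :: "('b, 'k::ab_group_add) tensors"
  unfolding tensors_upto_iff lookup_minus by (metis diff_0_right)

lemma tensors_upto_sum:
  "(\<And>x. x \<in> S \<Longrightarrow> f x \<in> tensors_upto n) \<Longrightarrow> sum f S \<in> tensors_upto n"
  for f :: "'a \<Rightarrow> ('b, 'k::comm_monoid_add) tensors"
  by (induction S rule: infinite_finite_induct) (simp_all add: tensors_upto_add)

lemma tensors_upto_scale: "p \<in> tensors_upto n \<Longrightarrow> scale c p \<in> tensors_upto n"
  unfolding tensors_upto_iff by (metis lookup_scale mult_zero_right)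

lemma tensors_upto_mono: "m \<le> n \<Longrightarrow> tensors_upto m \<subseteq> tensors_upto n"
  unfolding tensors_upto_def by fastforce

lemma tensors_upto_mult:
  fixes p q :: "('b, 'k::semiring_0) tensors"
  assumes "p \<in> tensors_upto m" "q \<in> tensors_upto n" "m + n \<le> k"
  shows "p * q \<in> tensors_upto k"
  unfolding tensors_upto_def
proof (intro CollectI ballI)
  fix w assume "w \<in> Poly_Mapping.keys (p * q)"
  then obtain u v where "w = u + v" "u \<in> Poly_Mapping.keys p" "v \<in> Poly_Mapping.keys q"
    using keys_mult by blast
  with assms show "int (length (letters w)) \<le> k"
    by (fastforce simp: tensors_upto_def length_letters_add)
qed

lemma component_in_tensors_upto: "int n \<le> m \<Longrightarrow> component n p \<in> tensors_upto m"
  by (auto simp: tensors_upto_iff lookup_component)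

lemma component_tensors_upto_eq_0:
  "p \<in> tensors_upto m \<Longrightarrow> m < int n \<Longrightarrow> component n p = 0"
  by (rule poly_mapping_eqI) (auto simp: lookup_component tensors_upto_iff)

lemma diff_component_in_tensors_upto:
  "p \<in> tensors_upto (int n) \<Longrightarrow> p - component n p \<in> tensors_upto (int n - 1)"
  for p :: "('b, 'k::ab_group_add) tensors"
  by (force simp: tensors_upto_iff lookup_component lookup_minus split: if_splits)

lemma tensor_power_iff: "p \<in> tensor_power n \<longleftrightarrow> component n p = p"
  by (auto simp: tensor_power_def poly_mapping_eq_iff fun_eq_iff lookup_component in_keys_iff)

lemma component_tensor_power:
  "p \<in> tensor_power n \<Longrightarrow> component m p = (if m = n then p else 0)"
  by (metis component_component tensor_power_iff)

text \<open>Exactly the degrees with a nonzero component; summing over them keeps the decomposition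
  into components finite.\<close>

definition lengths :: "('b, 'k::zero) tensors \<Rightarrow> nat set"
  where "lengths p = (\<lambda>w. length (letters w)) ` Poly_Mapping.keys p"

lemma finite_lengths [simp]: "finite (lengths p)"
  by (simp add: lengths_def)

lemma component_eq_0_if_notin_lengths: "n \<notin> lengths p \<Longrightarrow> component n p = 0"
  by (rule poly_mapping_eqI) (auto simp: lengths_def lookup_component in_keys_iff)

lemma sum_component_lengths: "(\<Sum>n\<in>lengths p. component n p) = p"
  for p :: "('b, 'k::comm_monoid_add) tensors"
  by (rule poly_mapping_eqI)
     (auto simp: lookup_sum lookup_component lengths_def in_keys_iff)

lemma lookup_incl: "Poly_Mapping.lookup (incl v) w =
  (case letters w of [i] \<Rightarrow> Poly_Mapping.lookup v i | _ \<Rightarrow> 0)"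
proof -
  obtain l where w: "w = Word l" by (cases w)
  show ?thesis
    by (auto simp: incl_def w lookup_sum lookup_single when_def in_keys_iff split: list.splits)
qed

lemma incl_tensor_power: "incl v \<in> tensor_power 1"
  by (auto simp: tensor_power_def in_keys_iff lookup_incl split: list.splits)

lemma incl_in_tensors_upto: "incl v \<in> tensors_upto 1"
  by (auto simp: tensors_upto_iff lookup_incl split: list.splits)

lemma tensor_power_add:
  "p \<in> tensor_power n \<Longrightarrow> q \<in> tensor_power n \<Longrightarrow> p + q \<in> tensor_power n"
  for p q :: "('b, 'k::monoid_add) tensors"
  by (simp add: tensor_power_iff component_add)

lemma tensor_power_diff:
  "p \<in> tensor_power n \<Longrightarrow> q \<in> tensor_power n \<Longrightarrow> p - q \<in> tensor_power n"
  for p q :: "('b, 'k::ab_group_add) tensors"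
  by (simp add: tensor_power_iff component_diff)

lemma tensor_power_mult:
  "p \<in> tensor_power m \<Longrightarrow> q \<in> tensor_power n \<Longrightarrow> p * q \<in> tensor_power (m + n)"
  for p q :: "('b, 'k::semiring_0) tensors"
  using keys_mult[of p q] by (fastforce simp: tensor_power_def length_letters_add)

section \<open>Quotients of the tensor algebra\<close>

lemma tensor_algebra_simps [simp]:
  "carrier tensor_algebra = UNIV" "mult tensor_algebra = (*)" "one tensor_algebra = 1"
  "zero tensor_algebra = 0" "add tensor_algebra = (+)" "smult tensor_algebra = scale"
  by (simp_all add: tensor_algebra_def)

text \<open>Negation is multiplication by \<open>-1\<close>, so these closure properties already
  give an additive subgroup.\<close>

lemma ideal_tensor_algebraI:
  fixes S :: "('b, 'k::field) tensors set"
  assumes zero: "0 \<in> S"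
    and add: "\<And>p q. p \<in> S \<Longrightarrow> q \<in> S \<Longrightarrow> p + q \<in> S"
    and left: "\<And>p q. p \<in> S \<Longrightarrow> q * p \<in> S"
    and right: "\<And>p q. p \<in> S \<Longrightarrow> p * q \<in> S"
  shows "ideal S tensor_algebra"
proof -
  interpret ring "tensor_algebra :: ('k, ('b, 'k) tensors) module"
    by (rule ring_tensor_algebra)
  have inv: "\<ominus>\<^bsub>tensor_algebra\<^esub> p = - p" for p :: "('b, 'k) tensors"
    by (rule minus_equality) auto
  have "- p \<in> S" if "p \<in> S" for p
    using left[OF that, of "-1"] by simp
  then have "subgroup S (add_monoid tensor_algebra)"
    by (intro add.subgroupI) (use zero add in \<open>auto simp: inv simp flip: a_inv_def\<close>)
  then show ?thesis
    by (rule idealI[OF ring_axioms]) (simp_all add: left right)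
qed

text \<open>Serves three ideals alike: the enveloping one, the homogeneous one, and the kernel of
  the symbol map.\<close>

locale tensor_ideal =
  fixes I :: "('b, 'k::field) tensors set"
  assumes ideal: "ideal I tensor_algebra"
begin

abbreviation coset :: "('b, 'k) tensors \<Rightarrow> ('b, 'k) tensors set"
  where "coset p \<equiv> I +>\<^bsub>tensor_algebra\<^esub> p"

abbreviation quot :: "('k, ('b, 'k) tensors set) module"
  where "quot \<equiv> quotient_algebra tensor_algebra I"

lemma zero_mem [simp]: "0 \<in> I"
  using additive_subgroup.zero_closed[OF ideal.axioms(1)[OF ideal]] by simp

lemma add_mem: "p \<in> I \<Longrightarrow> q \<in> I \<Longrightarrow> p + q \<in> I"
  using additive_subgroup.a_closed[OF ideal.axioms(1)[OF ideal]] by simp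

lemma mult_left_mem: "p \<in> I \<Longrightarrow> q * p \<in> I"
  using ideal.I_l_closed[OF ideal] by simp

lemma mult_right_mem: "p \<in> I \<Longrightarrow> p * q \<in> I"
  using ideal.I_r_closed[OF ideal] by simp

lemma scale_mem: "p \<in> I \<Longrightarrow> scale c p \<in> I"
  by (simp add: scale_eq_mult mult_left_mem)

lemma uminus_mem: "p \<in> I \<Longrightarrow> - p \<in> I"
  using mult_left_mem[of p "-1"] by simp

lemma diff_mem: "p \<in> I \<Longrightarrow> q \<in> I \<Longrightarrow> p - q \<in> I"
  using add_mem[of p "- q"] by (simp add: uminus_mem)

lemma sum_mem: "(\<And>x. x \<in> S \<Longrightarrow> f x \<in> I) \<Longrightarrow> sum f S \<in> I"
  by (induction S rule: infinite_finite_induct) (simp_all add: add_mem)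

lemma mem_coset: "q \<in> coset p \<longleftrightarrow> q - p \<in> I"
  by (auto simp: a_r_coset_def' intro: bexI[of _ "q - p"])

lemma coset_eq_iff: "coset p = coset q \<longleftrightarrow> p - q \<in> I"
proof
  assume "coset p = coset q"
  then show "p - q \<in> I" using mem_coset[of p p] mem_coset[of p q] by simp
next
  assume pq: "p - q \<in> I"
  show "coset p = coset q"
  proof (rule Set.set_eqI)
    fix r
    show "r \<in> coset p \<longleftrightarrow> r \<in> coset q"
      unfolding mem_coset using add_mem[OF pq, of "r - p"] diff_mem[OF _ pq, of "r - q"] by auto
  qed
qed

lemma coset_nonempty: "coset p \<noteq> {}"
  using mem_coset[of p p] by auto

lemma coset_quot:
  "coset p \<otimes>\<^bsub>quot\<^esub> coset q = coset (p * q)"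
  "coset p \<oplus>\<^bsub>quot\<^esub> coset q = coset (p + q)"
  "\<one>\<^bsub>quot\<^esub> = coset 1"
  "\<zero>\<^bsub>quot\<^esub> = coset 0"
  "carrier quot = range coset"
  using ideal.rcoset_mult_add[OF ideal, of p q] ideal.a_rcos_sum[OF ideal, of p q]
  by (auto simp: quotient_algebra_simps FactRing_def A_RCOSETS_def' a_r_coset_def')

lemma smult_coset: "c \<odot>\<^bsub>quot\<^esub> coset p = coset (scale c p)"
proof -
  \<comment> \<open>The scalar action of the quotient is a union over all representatives; each of
    them yields the same coset.\<close>
  have "coset (scale c q) = coset (scale c p)" if "q \<in> coset p" for q
    using scale_mem[of "q - p" c] that
    by (simp add: mem_coset coset_eq_iff scale_eq_mult right_diff_distrib)
  then show ?thesis
    using coset_nonempty[of p] unfolding quotient_algebra_simps tensor_algebra_simps by blast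
qed

lemma finsum_coset: "finite S \<Longrightarrow> (\<Oplus>\<^bsub>quot\<^esub>x\<in>S. coset (f x)) = coset (sum f S)"
proof -
  interpret abelian_monoid quot
    by (rule abelian_monoidI) (auto simp: coset_quot ac_simps)
  show "finite S \<Longrightarrow> ?thesis"
    by (induction S rule: finite_induct) (auto simp: coset_quot Pi_def)
qed

end

section \<open>The associated graded algebra of a quotient of the tensor algebra\<close>

context tensor_ideal
begin

abbreviation filt :: "int \<Rightarrow> ('b, 'k) tensors set set"
  where "filt n \<equiv> coset ` tensors_upto n"

abbreviation gr :: "('k, nat \<Rightarrow> ('b, 'k) tensors set set) module"
  where "gr \<equiv> assoc_graded quot filt"

text \<open>Elements of the graded pieces are cosets of cosets. Naming them by a tensor
  \<open>x\<close> lets all later arguments run on tensors.\<close>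

abbreviation filt_coset :: "int \<Rightarrow> ('b, 'k) tensors \<Rightarrow> ('b, 'k) tensors set set"
  where "filt_coset m x \<equiv> filt m +>\<^bsub>quot\<^esub> coset x"

lemma mem_filt_coset:
  "X \<in> filt_coset m x \<longleftrightarrow> (\<exists>z. X = coset z \<and> z - x \<in> tensors_upto m)"
proof -
  have "X \<in> filt_coset m x \<longleftrightarrow> (\<exists>t\<in>tensors_upto m. X = coset (t + x))"
    by (auto simp: a_r_coset_def'[of quot] coset_quot)
  also have "\<dots> \<longleftrightarrow> (\<exists>z. X = coset z \<and> z - x \<in> tensors_upto m)"
    by (metis add_diff_cancel_right' diff_add_cancel)
  finally show ?thesis .
qed

lemma filt_coset_cong:
  assumes "x - y \<in> tensors_upto m"
  shows "filt_coset m x = filt_coset m y"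
proof -
  have "z - x \<in> tensors_upto m \<longleftrightarrow> z - y \<in> tensors_upto m" for z
    using tensors_upto_add[OF assms, of "z - x"] tensors_upto_diff[OF _ assms, of "z - y"] by auto
  then show ?thesis by (auto simp: mem_filt_coset)
qed

text \<open>The two levels of cosets give two kinds of ambiguity: a tensor of degree at most
  \<open>m\<close> and an element of \<open>I\<close>.\<close>

lemma filt_coset_eq_iff:
  "filt_coset m x = filt_coset m y \<longleftrightarrow> (\<exists>t\<in>tensors_upto m. x - y - t \<in> I)"
proof
  assume "filt_coset m x = filt_coset m y"
  moreover have "coset x \<in> filt_coset m x"
    by (auto simp: mem_filt_coset)
  ultimately obtain z where "coset x = coset z" "z - y \<in> tensors_upto m"
    by (auto simp: mem_filt_coset)
  then show "\<exists>t\<in>tensors_upto m. x - y - t \<in> I"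
    by (intro bexI[of _ "z - y"]) (simp_all add: coset_eq_iff)
next
  assume "\<exists>t\<in>tensors_upto m. x - y - t \<in> I"
  then obtain t where t: "t \<in> tensors_upto m" "x - (y + t) \<in> I"
    by (auto simp: diff_diff_eq)
  then have "coset x = coset (y + t)"
    by (simp add: coset_eq_iff)
  with t(1) filt_coset_cong[of "y + t" y m] show "filt_coset m x = filt_coset m y"
    by simp
qed

lemma filt_coset_0: "filt_coset m 0 = filt m"
  by (auto simp: mem_filt_coset)

lemma filt_coset_add: "filt_coset m x <+>\<^bsub>quot\<^esub> filt_coset m y = filt_coset m (x + y)"
proof (intro equalityI subsetI)
  fix X assume "X \<in> filt_coset m x <+>\<^bsub>quot\<^esub> filt_coset m y"
  then obtain z w where "X = coset (z + w)" "z - x \<in> tensors_upto m" "w - y \<in> tensors_upto m"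
    by (auto simp: set_add_def'[of quot] mem_filt_coset coset_quot)
  then show "X \<in> filt_coset m (x + y)"
    using tensors_upto_add[of "z - x" m "w - y"] by (auto simp: mem_filt_coset algebra_simps)
next
  fix X assume "X \<in> filt_coset m (x + y)"
  then obtain z where "X = coset z" "z - (x + y) \<in> tensors_upto m"
    by (auto simp: mem_filt_coset)
  \<comment> \<open>The second summand is kept as \<open>y\<close> itself; the first absorbs the
    whole error of lower degree.\<close>
  then have "X = coset (z - y) \<oplus>\<^bsub>quot\<^esub> coset y"
    by (simp add: coset_quot)
  moreover have "coset (z - y) \<in> filt_coset m x"
    unfolding mem_filt_coset using \<open>z - (x + y) \<in> tensors_upto m\<close>
    by (intro exI[of _ "z - y"]) (simp add: diff_diff_eq add.commute)
  moreover have "coset y \<in> filt_coset m y"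
    by (auto simp: mem_filt_coset)
  ultimately show "X \<in> filt_coset m x <+>\<^bsub>quot\<^esub> filt_coset m y"
    unfolding set_add_def' by blast
qed

lemma filt_coset_smult:
  "(\<Union>X\<in>filt_coset m x. filt m +>\<^bsub>quot\<^esub> (c \<odot>\<^bsub>quot\<^esub> X)) = filt_coset m (scale c x)"
proof -
  have "filt m +>\<^bsub>quot\<^esub> (c \<odot>\<^bsub>quot\<^esub> X) = filt_coset m (scale c x)"
    if "X \<in> filt_coset m x" for X
  proof -
    obtain z where z: "X = coset z" "z - x \<in> tensors_upto m"
      using \<open>X \<in> filt_coset m x\<close> by (auto simp: mem_filt_coset)
    have "scale c z - scale c x \<in> tensors_upto m"
      using tensors_upto_scale[OF z(2), of c] by (simp add: scale_eq_mult right_diff_distrib)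
    then show ?thesis by (simp add: z(1) smult_coset filt_coset_cong)
  qed
  moreover have "coset x \<in> filt_coset m x"
    by (auto simp: mem_filt_coset)
  ultimately show ?thesis by blast
qed

section \<open>The symbol map onto the associated graded algebra\<close>

definition symbol :: "('b, 'k) tensors \<Rightarrow> nat \<Rightarrow> ('b, 'k) tensors set set"
  where "symbol p n = filt_coset (int n - 1) (component n p)"

lemma symbol_in_carrier: "symbol p \<in> carrier gr"
proof -
  have "symbol p n \<in> gr_component quot filt n" for n
    by (auto simp: symbol_def gr_component_def component_in_tensors_upto)
  moreover have "{n. symbol p n \<noteq> filt (int n - 1)} \<subseteq> lengths p"
    using component_eq_0_if_notin_lengths by (force simp: symbol_def filt_coset_0)
  then have "finite {n. symbol p n \<noteq> filt (int n - 1)}"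
    by (rule finite_subset) simp
  ultimately show ?thesis by (simp add: assoc_graded_def)
qed

text \<open>A class in degree \<open>n\<close> has a representative of degree at most
  \<open>n\<close>, and only its degree \<open>n\<close> component matters; the homogeneous
  representatives are then added up over the finite support \<open>S\<close>.\<close>

lemma symbol_surj: "carrier gr = range symbol"
proof (intro equalityI subsetI)
  fix f assume f: "f \<in> carrier gr"
  define S where "S = {n. f n \<noteq> filt (int n - 1)}"
  have "finite S" using f by (simp add: S_def assoc_graded_def)
  have "\<forall>n. \<exists>x. x \<in> tensors_upto (int n) \<and> f n = filt_coset (int n - 1) x"
    using f by (auto simp: assoc_graded_def gr_component_def)
  then obtain x where x: "\<And>n. x n \<in> tensors_upto (int n)" "\<And>n. f n = filt_coset (int n - 1) (x n)"
    by metis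
  define p where "p = (\<Sum>n\<in>S. component n (x n))"
  have "f n = symbol p n" for n
  proof (cases "n \<in> S")
    case True
    then have "component n p = component n (x n)"
      using \<open>finite S\<close> by (simp add: p_def component_sum component_component)
    moreover have "f n = filt_coset (int n - 1) (component n (x n))"
      unfolding x(2) by (intro filt_coset_cong diff_component_in_tensors_upto x(1))
    ultimately show ?thesis by (simp add: symbol_def)
  next
    case False
    then have "component n p = 0"
      by (auto simp: p_def component_sum component_component intro!: sum.neutral)
    with False show ?thesis by (simp add: symbol_def filt_coset_0 S_def)
  qed
  then show "f \<in> range symbol" by auto
qed (auto simp: symbol_in_carrier)

lemma symbol_add: "symbol p \<oplus>\<^bsub>gr\<^esub> symbol q = symbol (p + q)"
  by (simp add: assoc_graded_def symbol_def fun_eq_iff filt_coset_add component_add)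

lemma symbol_smult: "c \<odot>\<^bsub>gr\<^esub> symbol p = symbol (scale c p)"
  by (simp add: assoc_graded_def symbol_def fun_eq_iff filt_coset_smult component_scale)

lemma symbol_one: "\<one>\<^bsub>gr\<^esub> = symbol 1"
proof -
  have "component n (1 :: ('b, 'k) tensors) = (if n = 0 then 1 else 0)" for n
    using component_single[of n "0 :: 'b word" "1 :: 'k"] by (simp add: letters_zero)
  then show ?thesis
    by (simp add: assoc_graded_def symbol_def fun_eq_iff coset_quot filt_coset_0)
qed

lemma symbol_mult: "symbol p \<otimes>\<^bsub>gr\<^esub> symbol q = symbol (p * q)"
proof
  fix n
  let ?P = "\<lambda>u v. filt (int n - 1) +>\<^bsub>quot\<^esub> (\<Oplus>\<^bsub>quot\<^esub>i\<in>{..n}. u i \<otimes>\<^bsub>quot\<^esub> v (n - i))"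
  \<comment> \<open>The product is a union over all choices of representatives; each choice gives
    the same coset.\<close>
  have *: "?P u v = symbol (p * q) n" if "\<forall>i. u i \<in> symbol p i" "\<forall>i. v i \<in> symbol q i" for u v
  proof -
    from that obtain x y where
      x: "\<And>i. u i = coset (x i)" "\<And>i. x i - component i p \<in> tensors_upto (int i - 1)" and
      y: "\<And>i. v i = coset (y i)" "\<And>i. y i - component i q \<in> tensors_upto (int i - 1)"
      unfolding symbol_def mem_filt_coset by metis
    have x': "x i \<in> tensors_upto (int i)" for i
    proof -
      have "(x i - component i p) + component i p \<in> tensors_upto (int i)"
        using x(2)[of i] tensors_upto_mono[of "int i - 1" "int i"]
        by (intro tensors_upto_add component_in_tensors_upto) auto
      then show ?thesis by simp
    qed
    \<comment> \<open>The difference of products is split as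
      \<open>x (y - y') + (x - x') y'\<close>; each term loses at least one degree.\<close>
    have "x i * y (n - i) - component i p * component (n - i) q \<in> tensors_upto (int n - 1)"
      if "i \<le> n" for i
    proof -
      have "x i * (y (n - i) - component (n - i) q) \<in> tensors_upto (int n - 1)"
        by (rule tensors_upto_mult[OF x' y(2)]) (use that in auto)
      moreover have "(x i - component i p) * component (n - i) q \<in> tensors_upto (int n - 1)"
        by (rule tensors_upto_mult[OF x(2) component_in_tensors_upto[OF order_refl]])
           (use that in auto)
      ultimately show ?thesis
        using tensors_upto_add by (fastforce simp: algebra_simps)
    qed
    then have "(\<Sum>i\<le>n. x i * y (n - i)) - component n (p * q) \<in> tensors_upto (int n - 1)"
      unfolding component_mult sum_subtractf[symmetric] by (intro tensors_upto_sum) auto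
    then show ?thesis
      by (simp add: x(1) y(1) coset_quot finsum_coset symbol_def filt_coset_cong)
  qed
  \<comment> \<open>Some choice exists, so the union is taken over a nonempty family.\<close>
  have "\<exists>u. \<forall>i. u i \<in> symbol r i" for r
    by (rule exI[of _ "\<lambda>i. coset (component i r)"]) (auto simp: symbol_def mem_filt_coset)
  with * have "(\<Union>u\<in>{u. \<forall>i. u i \<in> symbol p i}. \<Union>v\<in>{v. \<forall>j. v j \<in> symbol q j}. ?P u v)
      = symbol (p * q) n"
    by (auto; blast)
  then show "(symbol p \<otimes>\<^bsub>gr\<^esub> symbol q) n = symbol (p * q) n"
    by (simp add: assoc_graded_def)
qed

lemma symbol_part: "assoc_graded_part quot filt n = symbol ` tensor_power n"
proof (intro equalityI subsetI)
  fix f assume f: "f \<in> assoc_graded_part quot filt n"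
  then obtain p where p: "f = symbol p"
    using symbol_surj by (auto simp: assoc_graded_part_def)
  have "f = symbol (component n p)"
  proof
    fix m show "f m = symbol (component n p) m"
      using f p by (cases "m = n")
        (auto simp: symbol_def assoc_graded_part_def component_component filt_coset_0)
  qed
  then show "f \<in> symbol ` tensor_power n"
    by (simp add: tensor_power_iff component_component)
next
  fix f assume "f \<in> symbol ` tensor_power n"
  then show "f \<in> assoc_graded_part quot filt n"
    by (auto simp: assoc_graded_part_def symbol_in_carrier symbol_def component_tensor_power filt_coset_0)
qed

section \<open>The kernel of the symbol map\<close>

text \<open>With \<open>t\<close> of degree below \<open>n\<close>, the condition says that each
  component of \<open>r\<close> is the degree \<open>n\<close> component of an element of
  \<open>I\<close> of degree at most \<open>n\<close>.\<close>

definition symbol_ideal :: "('b, 'k) tensors set"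
  where "symbol_ideal = {r. \<forall>n. \<exists>t\<in>tensors_upto (int n - 1). component n r - t \<in> I}"

lemma symbol_eq_iff: "symbol p = symbol q \<longleftrightarrow> p - q \<in> symbol_ideal"
  by (simp add: fun_eq_iff symbol_def filt_coset_eq_iff symbol_ideal_def component_diff)

lemma ideal_symbol_ideal: "ideal symbol_ideal tensor_algebra"
proof -
  have add: "p + q \<in> symbol_ideal" if p: "p \<in> symbol_ideal" and q: "q \<in> symbol_ideal" for p q
  proof -
    have "\<exists>t\<in>tensors_upto (int n - 1). component n (p + q) - t \<in> I" for n
    proof -
      from p obtain t where t: "t \<in> tensors_upto (int n - 1)" "component n p - t \<in> I"
        by (auto simp: symbol_ideal_def)
      from q obtain s where s: "s \<in> tensors_upto (int n - 1)" "component n q - s \<in> I"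
        by (auto simp: symbol_ideal_def)
      have "component n (p + q) - (t + s) \<in> I"
        using add_mem[OF t(2) s(2)] by (simp add: component_add algebra_simps)
      with tensors_upto_add[OF t(1) s(1)] show ?thesis by blast
    qed
    then show ?thesis by (simp add: symbol_ideal_def)
  qed
  have left: "p * r \<in> symbol_ideal" if "r \<in> symbol_ideal" for p r
  proof -
    from that obtain t where
      t: "\<And>n. t n \<in> tensors_upto (int n - 1)" "\<And>n. component n r - t n \<in> I"
      unfolding symbol_ideal_def by simp metis
    have "\<exists>s\<in>tensors_upto (int n - 1). component n (p * r) - s \<in> I" for n
    proof
      \<comment> \<open>The corrections are convolved as in \<open>component_mult\<close>; each term
        has degree at most \<open>i + (n - i - 1)\<close>.\<close>
      show "(\<Sum>i\<le>n. component i p * t (n - i)) \<in> tensors_upto (int n - 1)"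
        by (intro tensors_upto_sum tensors_upto_mult[OF component_in_tensors_upto[OF order_refl] t(1)])
           auto
      show "component n (p * r) - (\<Sum>i\<le>n. component i p * t (n - i)) \<in> I"
        unfolding component_mult sum_subtractf[symmetric] right_diff_distrib[symmetric]
        by (intro sum_mem mult_left_mem t(2))
    qed
    then show ?thesis by (simp add: symbol_ideal_def)
  qed
  have right: "r * p \<in> symbol_ideal" if "r \<in> symbol_ideal" for p r
  proof -
    from that obtain t where
      t: "\<And>n. t n \<in> tensors_upto (int n - 1)" "\<And>n. component n r - t n \<in> I"
      unfolding symbol_ideal_def by simp metis
    have "\<exists>s\<in>tensors_upto (int n - 1). component n (r * p) - s \<in> I" for n
    proof
      show "(\<Sum>i\<le>n. t i * component (n - i) p) \<in> tensors_upto (int n - 1)"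
        by (intro tensors_upto_sum tensors_upto_mult[OF t(1) component_in_tensors_upto[OF order_refl]])
           auto
      show "component n (r * p) - (\<Sum>i\<le>n. t i * component (n - i) p) \<in> I"
        unfolding component_mult sum_subtractf[symmetric] left_diff_distrib[symmetric]
        by (intro sum_mem mult_right_mem t(2))
    qed
    then show ?thesis by (simp add: symbol_ideal_def)
  qed
  have "0 \<in> symbol_ideal"
    by (auto simp: symbol_ideal_def intro!: bexI[of _ 0])
  then show ?thesis
    by (rule ideal_tensor_algebraI) (simp_all add: add left right)
qed

text \<open>First isomorphism theorem for the surjective homomorphism \<open>symbol\<close>.\<close>

theorem graded_isomorphic_quotient:
  assumes "J = symbol_ideal"
  shows "graded_isomorphic gr (assoc_graded_part quot filt)
    (quotient_algebra tensor_algebra J)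
    (\<lambda>n. (\<lambda>p. J +>\<^bsub>tensor_algebra\<^esub> p) ` tensor_power n)"
proof -
  interpret J: tensor_ideal J
    unfolding assms by (rule tensor_ideal.intro) (rule ideal_symbol_ideal)
  \<comment> \<open>A fibre of \<open>symbol\<close> is a coset of its kernel, so the fibre itself
    is the value of the isomorphism.\<close>
  define h where "h X = symbol -` {X}" for X
  have h: "h (symbol p) = J.coset p" for p
    by (auto simp: h_def J.mem_coset symbol_eq_iff simp flip: assms)
  have "h \<in> ring_hom gr J.quot"
  proof (rule ring_hom_memI)
    show "h \<one>\<^bsub>gr\<^esub> = \<one>\<^bsub>J.quot\<^esub>"
      by (simp add: symbol_one h J.coset_quot)
  qed (auto simp: symbol_surj h J.coset_quot symbol_mult symbol_add)
  moreover have "bij_betw h (carrier gr) (carrier J.quot)"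
    unfolding bij_betw_def inj_on_def symbol_surj J.coset_quot image_image
    by (auto simp: h J.coset_eq_iff symbol_eq_iff simp flip: assms)
  ultimately have "h \<in> ring_iso gr J.quot"
    by (simp add: ring_iso_def)
  moreover have "\<forall>c. \<forall>x\<in>carrier gr. h (c \<odot>\<^bsub>gr\<^esub> x) = c \<odot>\<^bsub>J.quot\<^esub> h x"
    by (auto simp: symbol_surj symbol_smult h J.smult_coset)
  moreover have "h ` assoc_graded_part quot filt n = J.coset ` tensor_power n" for n
    by (simp add: symbol_part image_image h)
  ultimately show ?thesis
    unfolding graded_isomorphic_def by blast
qed

end

section \<open>Comparison of the enveloping and the homogeneous ideal\<close>

lemma tensor_ideal_env_ideal: "tensor_ideal (env_ideal \<aa>)"
  by (rule tensor_ideal.intro) (rule ideal_env_ideal)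

lemma tensor_ideal_hom_ideal: "tensor_ideal (hom_ideal \<aa>)"
  by (rule tensor_ideal.intro) (rule ideal_hom_ideal)

lemma env_relations_subset: "env_relations \<aa> \<subseteq> env_ideal \<aa>"
  unfolding env_ideal_def by (rule ring.genideal_self[OF ring_tensor_algebra]) simp

lemma hom_relations_subset: "hom_relations \<aa> \<subseteq> hom_ideal \<aa>"
  unfolding hom_ideal_def by (rule ring.genideal_self[OF ring_tensor_algebra]) simp

text \<open>Every homogeneous relation is the top component of a multiple of an enveloping relation.\<close>

lemma hom_ideal_subset_symbol_ideal:
  fixes \<aa> :: "('b, 'k::field_char_0) superalgebra"
  shows "hom_ideal \<aa> \<subseteq> tensor_ideal.symbol_ideal (env_ideal \<aa>)"
proof -
  interpret I: tensor_ideal "env_ideal \<aa>"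
    by (rule tensor_ideal_env_ideal)
  \<comment> \<open>The correction \<open>t\<close> is used in degree 2; in every other degree the
    component of \<open>r\<close> is 0 and so is its correction.\<close>
  have key: "r \<in> I.symbol_ideal"
    if "r \<in> tensor_power 2" "t \<in> tensors_upto 1" "r - t \<in> env_ideal \<aa>" for r t
  proof -
    have "\<exists>t\<in>tensors_upto (int n - 1). component n r - t \<in> env_ideal \<aa>" for n
      using that by (intro bexI[of _ "if n = 2 then t else 0"]) (auto simp: component_tensor_power)
    then show ?thesis by (simp add: I.symbol_ideal_def)
  qed
  \<comment> \<open>Clears the factor \<open>1/2\<close> of the enveloping relations; here 2 has to
    be invertible.\<close>
  have two: "scale 2 (scale (1/2) p - q) = p - scale 2 q" for p q :: "('b, 'k) tensors"
    by (rule poly_mapping_eqI) (simp add: lookup_minus algebra_simps)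
  have deg2: "incl u * incl v \<in> tensor_power 2" for u v :: "'b \<Rightarrow>\<^sub>0 'k"
    using tensor_power_mult[OF incl_tensor_power incl_tensor_power, of u v] by (simp add: numeral_2_eq_2)
  have "hom_relations \<aa> \<subseteq> I.symbol_ideal"
  proof
    fix r assume "r \<in> hom_relations \<aa>"
    then consider
        s t where "r = incl s * incl t - incl t * incl s" "s \<in> odd_part \<aa>" "t \<in> odd_part \<aa>"
      | s x where "r = incl s * incl x + incl x * incl s" "s \<in> odd_part \<aa>" "x \<in> even_part \<aa>"
      | x y where "r = incl x * incl y" "x \<in> even_part \<aa>" "y \<in> even_part \<aa>"
      unfolding hom_relations_def by blast
    then show "r \<in> I.symbol_ideal"
    proof cases
      case 1
      then have "scale (1/2) r - incl (sprod \<aa> s t) \<in> env_relations \<aa>"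
        unfolding env_relations_def by blast
      note subsetD[OF env_relations_subset this]
      from I.scale_mem[OF this, of 2] show ?thesis
        unfolding two
        by (rule key[rotated 2])
           (auto simp: 1 deg2 tensor_power_diff tensors_upto_scale incl_in_tensors_upto)
    next
      case 2
      then have "scale (1/2) r - incl (sprod \<aa> s x) \<in> env_relations \<aa>"
        unfolding env_relations_def by blast
      note subsetD[OF env_relations_subset this]
      from I.scale_mem[OF this, of 2] show ?thesis
        unfolding two
        by (rule key[rotated 2])
           (auto simp: 2 deg2 tensor_power_add tensors_upto_scale incl_in_tensors_upto)
    next
      case 3
      then have "r - incl (sprod \<aa> x y) \<in> env_relations \<aa>"
        unfolding env_relations_def by blast
      note subsetD[OF env_relations_subset this]
      then show ?thesis
        by (rule key[rotated 2]) (auto simp: 3 deg2 incl_in_tensors_upto)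
    qed
  qed
  then show ?thesis
    unfolding hom_ideal_def
    by (rule ring.genideal_minimal[OF ring_tensor_algebra I.ideal_symbol_ideal])
qed

text \<open>The hypothesis yields the inclusion of the kernel in the homogeneous ideal, degree by
  degree; with the inclusion just proved the two ideals coincide.\<close>

theorem pbw_propertyI:
  fixes \<aa> :: "('b, 'k::field_char_0) superalgebra"
  assumes top: "\<And>n p. p \<in> env_ideal \<aa> \<Longrightarrow> p \<in> tensors_upto (int n) \<Longrightarrow> component n p \<in> hom_ideal \<aa>"
  shows "pbw_property \<aa>"
proof -
  interpret I: tensor_ideal "env_ideal \<aa>"
    by (rule tensor_ideal_env_ideal)
  interpret J: tensor_ideal "hom_ideal \<aa>"
    by (rule tensor_ideal_hom_ideal)
  have "I.symbol_ideal \<subseteq> hom_ideal \<aa>"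
  proof
    fix r assume r: "r \<in> I.symbol_ideal"
    have "component n r \<in> hom_ideal \<aa>" for n
    proof -
      from r obtain t where t: "t \<in> tensors_upto (int n - 1)" "component n r - t \<in> env_ideal \<aa>"
        by (auto simp: I.symbol_ideal_def)
      \<comment> \<open>This element of the enveloping ideal has top component
        \<open>component n r\<close>, since \<open>t\<close> lies in lower degree.\<close>
      have "component n r - t \<in> tensors_upto (int n)"
        using t(1) tensors_upto_mono[of "int n - 1" "int n"]
        by (intro tensors_upto_diff component_in_tensors_upto) auto
      from top[OF t(2) this] show ?thesis
        using component_tensors_upto_eq_0[OF t(1), of n] by (simp add: component_diff component_component)
    qed
    then have "(\<Sum>n\<in>lengths r. component n r) \<in> hom_ideal \<aa>"
      by (intro J.sum_mem)
    then show "r \<in> hom_ideal \<aa>" by (simp add: sum_component_lengths)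
  qed
  then have eq: "hom_ideal \<aa> = I.symbol_ideal"
    using hom_ideal_subset_symbol_ideal by blast
  have "env_filtration \<aa> = I.filt" "G_part \<aa> = (\<lambda>n. J.coset ` tensor_power n)"
    by (simp_all add: fun_eq_iff env_filtration_def G_part_def)
  with I.graded_isomorphic_quotient[OF eq] show ?thesis
    by (simp add: pbw_property_def env_algebra_def G_algebra_def)
qed

section \<open>Linear actions of the tensor algebra\<close>

text \<open>The operators act on arbitrary functions, that is, on possibly infinite formal sums,
  which spares any bookkeeping of supports.\<close>

locale word_action =
  fixes act :: "'b \<Rightarrow> ('x \<Rightarrow> 'k::field) \<Rightarrow> 'x \<Rightarrow> 'k"
  assumes act_add: "act i (\<lambda>x. u x + v x) = (\<lambda>x. act i u x + act i v x)"
    and act_scale: "act i (\<lambda>x. c * v x) = (\<lambda>x. c * act i v x)"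
begin

text \<open>The last letter acts first, so concatenation becomes composition and the vectors form a
  left module.\<close>

definition word_act :: "'b word \<Rightarrow> ('x \<Rightarrow> 'k) \<Rightarrow> 'x \<Rightarrow> 'k"
  where "word_act w = foldr act (letters w)"

lemma word_act_simps [simp]:
  "word_act (Word []) v = v"
  "word_act (Word (i # l)) v = act i (word_act (Word l) v)"
  by (simp_all add: word_act_def)

lemma word_act_plus: "word_act (w + w') v = word_act w (word_act w' v)"
  by (simp add: word_act_def plus_word_def)

lemma word_act_add: "word_act w (\<lambda>x. u x + v x) = (\<lambda>x. word_act w u x + word_act w v x)"
proof (induction w)
  case (Word l)
  show ?case by (induction l) (simp_all add: act_add)
qed

lemma word_act_scale: "word_act w (\<lambda>x. c * v x) = (\<lambda>x. c * word_act w v x)"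
proof (induction w)
  case (Word l)
  show ?case by (induction l) (simp_all add: act_scale)
qed

definition tensor_act :: "('b, 'k) tensors \<Rightarrow> ('x \<Rightarrow> 'k) \<Rightarrow> 'x \<Rightarrow> 'k"
  where "tensor_act p v x = (\<Sum>w\<in>Poly_Mapping.keys p. Poly_Mapping.lookup p w * word_act w v x)"

lemma tensor_act_superset:
  assumes "finite S" "Poly_Mapping.keys p \<subseteq> S"
  shows "tensor_act p v x = (\<Sum>w\<in>S. Poly_Mapping.lookup p w * word_act w v x)"
  unfolding tensor_act_def using assms
  by (intro sum.mono_neutral_left) (auto simp: in_keys_iff)

lemma tensor_act_single: "tensor_act (Poly_Mapping.single w c) v = (\<lambda>x. c * word_act w v x)"
  by (auto simp: tensor_act_def fun_eq_iff)

lemma tensor_act_add: "tensor_act (p + q) v = (\<lambda>x. tensor_act p v x + tensor_act q v x)"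
  unfolding tensor_act_def fun_eq_iff
  by (intro allI setsum_keys_plus_distrib) (simp_all add: distrib_right)

lemma tensor_act_scale: "tensor_act (scale c p) v = (\<lambda>x. c * tensor_act p v x)"
  by (induction p rule: poly_mapping_additive_induct)
     (simp_all add: tensor_act_single tensor_act_add scale_add_right distrib_left mult.assoc)

lemma tensor_act_diff: "tensor_act (p - q) v = (\<lambda>x. tensor_act p v x - tensor_act q v x)"
  using tensor_act_add[of "p - q" q v] by (simp add: fun_eq_iff)

lemma tensor_act_scale_right: "tensor_act p (\<lambda>x. c * v x) = (\<lambda>x. c * tensor_act p v x)"
  by (simp add: tensor_act_def fun_eq_iff word_act_scale sum_distrib_left mult.left_commute)

lemma tensor_act_mult: "tensor_act (p * q) v = tensor_act p (tensor_act q v)"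
proof (induction p rule: poly_mapping_additive_induct)
  case (single w c)
  show ?case
    by (induction q rule: poly_mapping_additive_induct)
       (simp_all add: mult_single tensor_act_single word_act_plus word_act_scale word_act_add
         tensor_act_add distrib_left mult.assoc)
next
  case (add f g)
  then show ?case by (simp add: distrib_right tensor_act_add)
qed

text \<open>Quantifying over all vectors makes the annihilator two-sided: \<open>p * q\<close>
  applies \<open>p\<close> to the vector \<open>tensor_act q v\<close>.\<close>

lemma ideal_annihilator: "ideal {p. \<forall>v. tensor_act p v = (\<lambda>_. 0)} tensor_algebra"
proof (rule ideal_tensor_algebraI)
  have "tensor_act p (\<lambda>_. 0) = (\<lambda>_. 0)" for p
    using tensor_act_scale_right[of p 0] by simp
  then show "q * p \<in> {p. \<forall>v. tensor_act p v = (\<lambda>_. 0)}"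
    if "p \<in> {p. \<forall>v. tensor_act p v = (\<lambda>_. 0)}" for p q
    using that by (simp add: tensor_act_mult)
qed (simp_all add: tensor_act_mult tensor_act_add, simp add: tensor_act_def fun_eq_iff)

end

section \<open>The action of K3 on normal forms\<close>

text \<open>
  A function \<open>v\<close> on \<open>bool \<times> nat \<times> nat\<close> stands for the formal sum of the normal monomials
  \<open>a\<^sup>i b\<^sup>j\<close> with coefficient \<open>v (False, i, j)\<close> and \<open>\<epsilon> a\<^sup>i b\<^sup>j\<close> with coefficient \<open>v (True, i, j)\<close>.
  The operators below are left multiplication in the enveloping algebra, computed from
  \<open>\<epsilon>\<^sup>2 = \<epsilon>\<close>, \<open>a \<epsilon> = (1 - \<epsilon>) a\<close>, \<open>b \<epsilon> = (1 - \<epsilon>) b\<close> and, as a consequence of \<open>b a = a b - \<epsilon>\<close>,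
  \<open>b a\<^sup>i = a\<^sup>i b - (i div 2 + (i mod 2) \<epsilon>) a\<^bsup>i-1\<^esup>\<close>.
\<close>

type_synonym 'k normal_form = "bool \<times> nat \<times> nat \<Rightarrow> 'k"

fun k3_act :: "k3_basis \<Rightarrow> ('k::field) normal_form \<Rightarrow> 'k normal_form" where
  "k3_act Eps v (e, i, j) = (if e then v (False, i, j) + v (True, i, j) else 0)"
| "k3_act OddA v (e, i, j) =
    (if i = 0 then 0
     else if e then - v (True, i - 1, j)
     else v (False, i - 1, j) + v (True, i - 1, j))"
| "k3_act OddB v (e, i, j) =
    (if e then
       of_nat (Suc i div 2) * v (True, Suc i, j) - (if even i then v (False, Suc i, j) else 0)
         - (if j = 0 then 0 else v (True, i, j - 1))
     else
       (if j = 0 then 0 else v (False, i, j - 1) + v (True, i, j - 1))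
         - of_nat (Suc i div 2) * (v (False, Suc i, j) + v (True, Suc i, j)))"

lemma k3_act_add: "k3_act c (\<lambda>x. u x + v x) = (\<lambda>x. k3_act c u x + k3_act c v x)"
proof
  fix x :: "bool \<times> nat \<times> nat"
  obtain e i j where "x = (e, i, j)" by (metis prod.exhaust)
  then show "k3_act c (\<lambda>x. u x + v x) x = k3_act c u x + k3_act c v x"
    by (cases c) (simp_all add: algebra_simps)
qed

lemma k3_act_scale: "k3_act c (\<lambda>x. r * v x) = (\<lambda>x. r * k3_act c v x)"
proof
  fix x :: "bool \<times> nat \<times> nat"
  obtain e i j where "x = (e, i, j)" by (metis prod.exhaust)
  then show "k3_act c (\<lambda>x. r * v x) x = r * k3_act c v x"
    by (cases c) (simp_all add: algebra_simps)
qed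

interpretation k3: word_action k3_act
  by standard (rule k3_act_add k3_act_scale)+

section \<open>The enveloping relations hold for the operators\<close>

text \<open>This and the next three identities are the relations between basis elements, cleared of
  \<open>1/2\<close>: the consistency check for the rewriting rules encoded in
  \<open>k3_act\<close>.\<close>

lemma k3_act_Eps_Eps: "k3_act Eps (k3_act Eps v) x = k3_act Eps v x"
  by (cases x rule: prod_cases3) simp

lemma k3_act_OddA_Eps: "k3_act OddA (k3_act Eps v) x + k3_act Eps (k3_act OddA v) x = k3_act OddA v x"
  by (cases x rule: prod_cases3) simp

lemma k3_act_OddB_Eps: "k3_act OddB (k3_act Eps v) x + k3_act Eps (k3_act OddB v) x = k3_act OddB v x"
  by (cases x rule: prod_cases3) (simp add: algebra_simps)

lemma k3_act_OddA_OddB: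
  "k3_act OddA (k3_act OddB v) x - k3_act OddB (k3_act OddA v) x = k3_act Eps v x"
proof (cases x rule: prod_cases3)
  case (fields e i j)
  show ?thesis
  proof (cases i)
    case 0
    then show ?thesis by (simp add: fields)
  next
    case (Suc m)
    \<comment> \<open>The coefficients \<open>Suc i div 2\<close> belonging to \<open>i\<close> and
      to \<open>m = i - 1\<close> differ exactly when \<open>m\<close> is even.\<close>
    then show ?thesis
      by (cases "even m"; cases j; cases e) (simp_all add: fields algebra_simps)
  qed
qed

lemma tensor_act_incl:
  "k3.tensor_act (incl s) v x =
     Poly_Mapping.lookup s Eps * k3_act Eps v x + Poly_Mapping.lookup s OddA * k3_act OddA v x
       + Poly_Mapping.lookup s OddB * k3_act OddB v x"
proof -
  have "Poly_Mapping.keys (incl s) \<subseteq> {Word [Eps], Word [OddA], Word [OddB]}"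
  proof
    fix w assume "w \<in> Poly_Mapping.keys (incl s)"
    then obtain i where "w = Word [i]"
      by (cases w) (auto simp: in_keys_iff lookup_incl split: list.splits)
    then show "w \<in> {Word [Eps], Word [OddA], Word [OddB]}"
      by (cases i) simp_all
  qed
  from k3.tensor_act_superset[OF _ this] show ?thesis
    by (simp add: lookup_incl add.assoc)
qed

text \<open>Terms outside the supports vanish, so the sums may run over the whole basis and unfold
  to an explicit formula.\<close>

lemma lookup_sprod_K3:
  "Poly_Mapping.lookup (sprod K3 u v) k =
    (\<Sum>i\<in>{Eps, OddA, OddB}. \<Sum>j\<in>{Eps, OddA, OddB}.
       Poly_Mapping.lookup u i * Poly_Mapping.lookup v j * Poly_Mapping.lookup (k3_bprod i j) k)"
proof -
  let ?f = "\<lambda>i j. Poly_Mapping.lookup u i * Poly_Mapping.lookup v j * Poly_Mapping.lookup (k3_bprod i j) k"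
  have "i \<in> {Eps, OddA, OddB}" for i
    by (cases i) simp_all
  then have UNIV: "{Eps, OddA, OddB} = UNIV"
    by blast
  have fin: "finite (UNIV :: k3_basis set)"
    by (subst UNIV[symmetric]) simp
  have inner: "(\<Sum>j\<in>Poly_Mapping.keys v. ?f i j) = (\<Sum>j\<in>UNIV. ?f i j)" for i
    by (rule sum.mono_neutral_left) (auto simp: fin in_keys_iff)
  have outer: "(\<Sum>i\<in>Poly_Mapping.keys u. \<Sum>j\<in>UNIV. ?f i j) = (\<Sum>i\<in>UNIV. \<Sum>j\<in>UNIV. ?f i j)"
    by (rule sum.mono_neutral_left) (auto simp: fin in_keys_iff)
  show ?thesis
    unfolding UNIV by (simp add: sprod_def lookup_sum K3_def inner outer)
qed

lemma odd_part_K3: "s \<in> odd_part K3 \<longleftrightarrow> Poly_Mapping.lookup s Eps = 0"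
proof -
  have "(\<forall>i\<in>S. k3_odd i) \<longleftrightarrow> Eps \<notin> S" for S
    by (metis k3_basis.exhaust k3_odd.simps)
  then show ?thesis by (simp add: odd_part_def K3_def in_keys_iff)
qed

lemma even_part_K3:
  "s \<in> even_part K3 \<longleftrightarrow> Poly_Mapping.lookup s OddA = 0 \<and> Poly_Mapping.lookup s OddB = 0"
proof -
  have "(\<forall>i\<in>S. \<not> k3_odd i) \<longleftrightarrow> OddA \<notin> S \<and> OddB \<notin> S" for S
    by (metis k3_basis.exhaust k3_odd.simps)
  then show ?thesis by (simp add: even_part_def K3_def in_keys_iff)
qed

lemma tensor_act_env_relations:
  fixes r :: "(k3_basis, 'k::field_char_0) tensors"
  assumes "r \<in> env_relations K3"
  shows "k3.tensor_act r v = (\<lambda>_. 0)"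
proof -
  have inclE: "k3.tensor_act (incl x) v = (\<lambda>y. Poly_Mapping.lookup x Eps * k3_act Eps v y)"
    if "x \<in> even_part K3" for x and v :: "'k normal_form"
    using that by (simp add: fun_eq_iff tensor_act_incl even_part_K3)
  have inclO: "k3.tensor_act (incl s) v = (\<lambda>y. Poly_Mapping.lookup s OddA * k3_act OddA v y
      + Poly_Mapping.lookup s OddB * k3_act OddB v y)"
    if "s \<in> odd_part K3" for s and v :: "'k normal_form"
    using that by (simp add: fun_eq_iff tensor_act_incl odd_part_K3)
  \<comment> \<open>These rewrite rules are oriented so that \<open>Eps\<close> ends up outermost
    and \<open>OddB\<close> outside \<open>OddA\<close>.\<close>
  have AB: "k3_act OddA (k3_act OddB v) y = k3_act OddB (k3_act OddA v) y + k3_act Eps v y" for y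
    using k3_act_OddA_OddB[of v y] by (simp add: algebra_simps)
  have AE: "k3_act OddA (k3_act Eps v) y = k3_act OddA v y - k3_act Eps (k3_act OddA v) y" for y
    using k3_act_OddA_Eps[of v y] by (simp add: algebra_simps)
  have BE: "k3_act OddB (k3_act Eps v) y = k3_act OddB v y - k3_act Eps (k3_act OddB v) y" for y
    using k3_act_OddB_Eps[of v y] by (simp add: algebra_simps)
  from assms consider
      s t where "r = scale (1/2) (incl s * incl t - incl t * incl s) - incl (sprod K3 s t)"
        "s \<in> odd_part K3" "t \<in> odd_part K3"
    | s x where "r = scale (1/2) (incl s * incl x + incl x * incl s) - incl (sprod K3 s x)"
        "s \<in> odd_part K3" "x \<in> even_part K3"
    | x y where "r = incl x * incl y - incl (sprod K3 x y)"
        "x \<in> even_part K3" "y \<in> even_part K3"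
    unfolding env_relations_def by blast
  then show ?thesis
  proof cases
    case 1
    \<comment> \<open>The products \<open>aa\<close> and \<open>bb\<close> are zero, and their
      counterparts cancel in the commutator; what remains is half the determinant of the coordinates
      times \<epsilon>.\<close>
    then have "k3.tensor_act (incl (sprod K3 s t)) v =
        (\<lambda>y. (Poly_Mapping.lookup s OddA * Poly_Mapping.lookup t OddB
          - Poly_Mapping.lookup s OddB * Poly_Mapping.lookup t OddA) / 2 * k3_act Eps v y)"
      by (simp add: fun_eq_iff tensor_act_incl odd_part_K3 lookup_sprod_K3 lookup_single diff_divide_distrib)
    with 1(2,3) show ?thesis
      unfolding 1(1)
      by (intro ext) (simp add: k3.tensor_act_diff k3.tensor_act_scale k3.tensor_act_mult inclO
          k3_act_add k3_act_scale AB field_simps)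
  next
    case 2
    then have "k3.tensor_act (incl (sprod K3 s x)) v = (\<lambda>y. Poly_Mapping.lookup x Eps / 2 *
        (Poly_Mapping.lookup s OddA * k3_act OddA v y + Poly_Mapping.lookup s OddB * k3_act OddB v y))"
      by (simp add: fun_eq_iff tensor_act_incl odd_part_K3 even_part_K3 lookup_sprod_K3 lookup_single
          field_simps)
    with 2(2,3) show ?thesis
      unfolding 2(1)
      by (intro ext) (simp add: k3.tensor_act_diff k3.tensor_act_scale k3.tensor_act_mult k3.tensor_act_add
          inclO inclE k3_act_add k3_act_scale AE BE field_simps)
  next
    case 3
    then have "k3.tensor_act (incl (sprod K3 x y)) v =
        (\<lambda>z. Poly_Mapping.lookup x Eps * Poly_Mapping.lookup y Eps * k3_act Eps v z)"
      by (simp add: fun_eq_iff tensor_act_incl even_part_K3 lookup_sprod_K3 lookup_single)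
    with 3(2,3) show ?thesis
      unfolding 3(1)
      by (intro ext) (simp add: k3.tensor_act_diff k3.tensor_act_mult inclE k3_act_scale k3_act_Eps_Eps)
  qed
qed

text \<open>The annihilator is an ideal containing the generating relations.\<close>

lemma tensor_act_env_ideal:
  fixes p :: "(k3_basis, 'k::field_char_0) tensors"
  assumes "p \<in> env_ideal K3"
  shows "k3.tensor_act p v = (\<lambda>_. 0)"
proof -
  have "env_ideal K3 \<subseteq> {p :: (k3_basis, 'k) tensors. \<forall>v. k3.tensor_act p v = (\<lambda>_. 0)}"
    unfolding env_ideal_def
    by (rule ring.genideal_minimal[OF ring_tensor_algebra k3.ideal_annihilator])
       (auto simp: tensor_act_env_relations)
  with assms show ?thesis by blast
qed

section \<open>Normal forms modulo the homogeneous relations\<close>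

abbreviation k3_gen :: "k3_basis \<Rightarrow> (k3_basis, 'k::field) tensors"
  where "k3_gen c \<equiv> Poly_Mapping.single (Word [c]) 1"

definition k3_monomial :: "bool \<Rightarrow> nat \<Rightarrow> nat \<Rightarrow> (k3_basis, 'k::field) tensors"
  where "k3_monomial e i j = Poly_Mapping.single
    (Word ((if e then [Eps] else []) @ replicate i OddA @ replicate j OddB)) 1"

text \<open>The factor \<epsilon> counts as one degree, hence \<open>i < n\<close> and
  \<open>n - Suc i\<close> in the second sum.\<close>

definition top_part :: "nat \<Rightarrow> ('k::field) normal_form \<Rightarrow> (k3_basis, 'k) tensors"
  where "top_part n v =
    (\<Sum>i\<le>n. scale (v (False, i, n - i)) (k3_monomial False i (n - i)))
    + (\<Sum>i<n. scale (v (True, i, n - Suc i)) (k3_monomial True i (n - Suc i)))"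

text \<open>The second bound is stricter by one because of the leading \<epsilon>.\<close>

definition degree_le :: "nat \<Rightarrow> ('k::field) normal_form \<Rightarrow> bool"
  where "degree_le n v \<longleftrightarrow>
    (\<forall>i j. n < i + j \<longrightarrow> v (False, i, j) = 0) \<and> (\<forall>i j. n \<le> i + j \<longrightarrow> v (True, i, j) = 0)"

lemma degree_le_k3_act:
  assumes "degree_le n v"
  shows "degree_le (Suc n) (k3_act c v)"
proof (cases c)
  case Eps
  then show ?thesis using assms by (simp add: degree_le_def)
next
  case OddA
  have "i - Suc 0 + j \<ge> n" if "Suc n \<le> i + j" for i j
    using that by linarith
  then show ?thesis using assms OddA by (auto simp: degree_le_def)
next
  case OddB
  have "i + (j - Suc 0) \<ge> n" if "Suc n \<le> i + j" for i j
    using that by linarith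
  then show ?thesis using assms OddB by (auto simp: degree_le_def)
qed

lemma top_part_eq_0: "degree_le m v \<Longrightarrow> m < n \<Longrightarrow> top_part n v = 0"
  by (auto simp: top_part_def degree_le_def intro!: sum.neutral)

lemma top_part_linear:
  "top_part n (\<lambda>x. \<Sum>w\<in>S. c w * f w x) = (\<Sum>w\<in>S. scale (c w) (top_part n (f w)))"
proof (induction S rule: infinite_finite_induct)
  case (insert w S)
  have "top_part n (\<lambda>x. c w * f w x + g x) = scale (c w) (top_part n (f w)) + top_part n g" for g
    by (simp add: top_part_def scale_add_left scale_add_right scale_sum scale_scale sum.distrib algebra_simps)
  with insert show ?case by simp
qed (simp_all add: top_part_def)

section \<open>Left multiplication modulo the homogeneous ideal\<close>

context
  fixes J :: "(k3_basis, 'k::field) tensors set"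
  assumes J: "J = hom_ideal K3"
begin

interpretation J: tensor_ideal J
  unfolding J by (rule tensor_ideal_hom_ideal)

lemma gen_relations:
  "k3_gen Eps * k3_gen Eps \<in> J"
  "k3_gen OddA * k3_gen Eps + k3_gen Eps * k3_gen OddA \<in> J"
  "k3_gen OddB * k3_gen Eps + k3_gen Eps * k3_gen OddB \<in> J"
  "k3_gen OddB * k3_gen OddA - k3_gen OddA * k3_gen OddB \<in> J"
proof -
  let ?s = "\<lambda>i. Poly_Mapping.single i (1::'k)"
  have parts: "?s Eps \<in> even_part K3" "?s OddA \<in> odd_part K3" "?s OddB \<in> odd_part K3"
    by (simp_all add: odd_part_K3 even_part_K3 lookup_single)
  have "incl (?s Eps) * incl (?s Eps) \<in> hom_relations K3"
    "incl (?s OddA) * incl (?s Eps) + incl (?s Eps) * incl (?s OddA) \<in> hom_relations K3"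
    "incl (?s OddB) * incl (?s Eps) + incl (?s Eps) * incl (?s OddB) \<in> hom_relations K3"
    "incl (?s OddB) * incl (?s OddA) - incl (?s OddA) * incl (?s OddB) \<in> hom_relations K3"
    using parts unfolding hom_relations_def by blast+
  then show "k3_gen Eps * k3_gen Eps \<in> J"
    "k3_gen OddA * k3_gen Eps + k3_gen Eps * k3_gen OddA \<in> J"
    "k3_gen OddB * k3_gen Eps + k3_gen Eps * k3_gen OddB \<in> J"
    "k3_gen OddB * k3_gen OddA - k3_gen OddA * k3_gen OddB \<in> J"
    unfolding J incl_single using hom_relations_subset by blast+
qed

lemma monomial_True: "k3_monomial True i j = k3_gen Eps * k3_monomial False i j"
  by (simp add: k3_monomial_def mult_single plus_word_def)

lemma monomial_Suc: "k3_monomial False (Suc i) j = k3_gen OddA * k3_monomial False i j"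
  by (simp add: k3_monomial_def mult_single plus_word_def)

lemma Eps_monomial_True: "k3_gen Eps * k3_monomial True i j \<in> J"
  unfolding monomial_True mult.assoc[symmetric] by (intro J.mult_right_mem gen_relations)

lemma OddA_monomial_True:
  "k3_gen OddA * k3_monomial True i j + k3_monomial True (Suc i) j \<in> J"
  using J.mult_right_mem[OF gen_relations(2), of "k3_monomial False i j"]
  by (simp add: monomial_True monomial_Suc distrib_right mult.assoc)

lemma OddB_monomial_False:
  "k3_gen OddB * k3_monomial False i j - k3_monomial False i (Suc j) \<in> J"
proof (induction i)
  case 0
  show ?case by (simp add: k3_monomial_def mult_single plus_word_def)
next
  case (Suc i)
  \<comment> \<open>First \<open>b\<close> passes one \<open>a\<close> by the relation, then the
    remaining power by the induction hypothesis.\<close>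
  have "(k3_gen OddB * k3_gen OddA - k3_gen OddA * k3_gen OddB) * k3_monomial False i j
      + k3_gen OddA * (k3_gen OddB * k3_monomial False i j - k3_monomial False i (Suc j)) \<in> J"
    by (intro J.add_mem J.mult_left_mem J.mult_right_mem gen_relations Suc)
  then show ?case
    by (simp add: monomial_Suc left_diff_distrib right_diff_distrib mult.assoc)
qed

lemma OddB_monomial_True:
  "k3_gen OddB * k3_monomial True i j + k3_monomial True i (Suc j) \<in> J"
proof -
  have "(k3_gen OddB * k3_gen Eps + k3_gen Eps * k3_gen OddB) * k3_monomial False i j
      - k3_gen Eps * (k3_gen OddB * k3_monomial False i j - k3_monomial False i (Suc j)) \<in> J"
    by (intro J.diff_mem J.mult_left_mem J.mult_right_mem gen_relations OddB_monomial_False)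
  then show ?thesis
    by (simp add: monomial_True distrib_right right_diff_distrib mult.assoc)
qed

lemma gen_top_part:
  "k3_gen c * top_part n v =
    (\<Sum>i\<le>n. scale (v (False, i, n - i)) (k3_gen c * k3_monomial False i (n - i)))
    + (\<Sum>i<n. scale (v (True, i, n - Suc i)) (k3_gen c * k3_monomial True i (n - Suc i)))"
  by (simp add: top_part_def distrib_left sum_distrib_left mult_scale_right)

text \<open>The terms by which the enveloping action deviates from the homogeneous rules have degree
  at most \<open>n\<close>; the degree bound on \<open>v\<close> removes them from degree
  \<open>Suc n\<close>.\<close>

lemma gen_mult_top_part:
  assumes "degree_le n v"
  shows "k3_gen c * top_part n v - top_part (Suc n) (k3_act c v) \<in> J"
proof (cases c)
  case Eps
  have "top_part (Suc n) (k3_act c v)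
      = (\<Sum>i\<le>n. scale (v (False, i, n - i)) (k3_gen c * k3_monomial False i (n - i)))"
    using assms unfolding top_part_def Eps lessThan_Suc_atMost
    by (simp add: degree_le_def monomial_True)
  \<comment> \<open>What is left are products of \<epsilon> with monomials already starting with
    \<epsilon>; they lie in \<open>J\<close>.\<close>
  then have "k3_gen c * top_part n v - top_part (Suc n) (k3_act c v)
      = (\<Sum>i<n. scale (v (True, i, n - Suc i)) (k3_gen c * k3_monomial True i (n - Suc i)))"
    by (simp add: gen_top_part)
  then show ?thesis
    by (simp add: Eps J.sum_mem J.scale_mem Eps_monomial_True)
next
  case OddA
  \<comment> \<open>Splitting off \<open>i = 0\<close>, where \<open>OddA\<close> gives 0, shifts
    the exponent of \<open>a\<close> by one.\<close>
  have "top_part (Suc n) (k3_act c v)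
      = (\<Sum>i\<le>n. scale (v (False, i, n - i)) (k3_gen c * k3_monomial False i (n - i)))
        - (\<Sum>i<n. scale (v (True, i, n - Suc i)) (k3_monomial True (Suc i) (n - Suc i)))"
    using assms unfolding top_part_def OddA sum.atMost_Suc_shift sum.lessThan_Suc_shift
    by (simp add: degree_le_def monomial_Suc scale_uminus_left sum_negf)
  then have "k3_gen c * top_part n v - top_part (Suc n) (k3_act c v)
      = (\<Sum>i<n. scale (v (True, i, n - Suc i))
          (k3_gen c * k3_monomial True i (n - Suc i) + k3_monomial True (Suc i) (n - Suc i)))"
    by (simp add: gen_top_part scale_add_right sum.distrib)
  then show ?thesis
    by (simp add: OddA J.sum_mem J.scale_mem OddA_monomial_True)
next
  case OddB
  \<comment> \<open>Here the last index is split off: the exponent of \<open>b\<close> is 0 there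
    and the term vanishes.\<close>
  have "top_part (Suc n) (k3_act c v)
      = (\<Sum>i\<le>n. scale (v (False, i, n - i)) (k3_monomial False i (Suc (n - i))))
        - (\<Sum>i<n. scale (v (True, i, n - Suc i)) (k3_monomial True i (Suc (n - Suc i))))"
    using assms
    unfolding top_part_def OddB sum.atMost_Suc sum.lessThan_Suc sum_negf[symmetric]
      diff_conv_add_uminus
    by (simp add: degree_le_def Suc_diff_le Suc_diff_Suc cong: if_cong flip: scale_uminus_left)
  then have "k3_gen c * top_part n v - top_part (Suc n) (k3_act c v)
      = (\<Sum>i\<le>n. scale (v (False, i, n - i))
          (k3_gen c * k3_monomial False i (n - i) - k3_monomial False i (Suc (n - i))))
        + (\<Sum>i<n. scale (v (True, i, n - Suc i))
          (k3_gen c * k3_monomial True i (n - Suc i) + k3_monomial True i (Suc (n - Suc i))))"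
    by (simp add: gen_top_part scale_add_right scale_diff_right sum.distrib sum_subtractf)
  then show ?thesis
    by (simp add: OddB J.add_mem J.sum_mem J.scale_mem OddB_monomial_True OddB_monomial_False)
qed

section \<open>Reduction of words and tensors to normal form\<close>

definition k3_unit :: "'k normal_form"
  where "k3_unit x = (if x = (False, 0, 0) then 1 else 0)"

text \<open>Both claims go through one induction, as \<open>gen_mult_top_part\<close> requires the
  degree bound at every letter.\<close>

lemma word_normal_form:
  "degree_le (length l) (k3.word_act (Word l) k3_unit) \<and>
   Poly_Mapping.single (Word l) 1 - top_part (length l) (k3.word_act (Word l) k3_unit) \<in> J"
proof (induction l)
  case Nil
  show ?case by (simp add: degree_le_def k3_unit_def top_part_def k3_monomial_def)
next
  case (Cons c l)
  let ?v = "k3.word_act (Word l) k3_unit"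
  have "k3_gen c * (Poly_Mapping.single (Word l) 1 - top_part (length l) ?v)
      + (k3_gen c * top_part (length l) ?v - top_part (Suc (length l)) (k3_act c ?v)) \<in> J"
    using Cons.IH by (intro J.add_mem J.mult_left_mem gen_mult_top_part) simp_all
  moreover have "k3_gen c * Poly_Mapping.single (Word l) 1 = Poly_Mapping.single (Word (c # l)) (1 :: 'k)"
    by (simp add: mult_single plus_word_def)
  ultimately show ?case
    using Cons.IH by (simp add: right_diff_distrib degree_le_k3_act)
qed

text \<open>By linearity this concerns single words of length at most \<open>n\<close>. Length
  \<open>n\<close> is \<open>word_normal_form\<close>; for a shorter word both terms are 0, the
  second by its degree bound.\<close>

lemma component_normal_form:
  assumes "p \<in> tensors_upto (int n)"
  shows "component n p - top_part n (k3.tensor_act p k3_unit) \<in> J"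
proof -
  let ?c = "Poly_Mapping.lookup p"
  have "component n p = (\<Sum>w\<in>Poly_Mapping.keys p. scale (?c w) (component n (Poly_Mapping.single w 1)))"
    by (rule poly_mapping_eqI)
       (simp add: lookup_sum lookup_component lookup_single when_def in_keys_iff flip: component_scale)
  moreover have "top_part n (k3.tensor_act p k3_unit)
      = (\<Sum>w\<in>Poly_Mapping.keys p. scale (?c w) (top_part n (k3.word_act w k3_unit)))"
    using top_part_linear[of n ?c "\<lambda>w. k3.word_act w k3_unit" "Poly_Mapping.keys p"]
    by (simp add: k3.tensor_act_def[abs_def])
  ultimately have "component n p - top_part n (k3.tensor_act p k3_unit) =
      (\<Sum>w\<in>Poly_Mapping.keys p. scale (?c w)
         (component n (Poly_Mapping.single w 1) - top_part n (k3.word_act w k3_unit)))"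
    by (simp add: scale_diff_right sum_subtractf)
  also have "\<dots> \<in> J"
  proof (intro J.sum_mem J.scale_mem)
    fix w assume "w \<in> Poly_Mapping.keys p"
    moreover obtain l where w: "w = Word l" by (cases w)
    ultimately consider "length l = n" | "length l < n"
      using assms by (force simp: tensors_upto_def)
    then show "component n (Poly_Mapping.single w 1) - top_part n (k3.word_act w k3_unit) \<in> J"
    proof cases
      case 1
      then show ?thesis using word_normal_form[of l] by (simp add: w component_single)
    next
      case 2
      then have "top_part n (k3.word_act w k3_unit) = 0"
        using word_normal_form[of l] by (auto simp: w intro: top_part_eq_0)
      with 2 show ?thesis by (simp add: w component_single)
    qed
  qed
  finally show ?thesis .
qed

end

theorem pbw_property_K3: "pbw_property (K3 :: (k3_basis, 'k::field_char_0) superalgebra)"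
proof (rule pbw_propertyI)
  fix n and p :: "(k3_basis, 'k) tensors"
  assume p: "p \<in> env_ideal K3" "p \<in> tensors_upto (int n)"
  \<comment> \<open>An element of the enveloping ideal kills every vector, in particular the unit,
    so its top component is congruent to 0.\<close>
  have "top_part n (k3.tensor_act p k3_unit) = 0"
    by (simp add: tensor_act_env_ideal[OF p(1)] top_part_def)
  with component_normal_form[OF refl p(2)] show "component n p \<in> hom_ideal K3"
    by simp
qed

theorem proposition2p7:
  shows "pbw_property (K3 :: (k3_basis, real) superalgebra)
       \<and> pbw_property (K3 :: (k3_basis, complex) superalgebra)"
  by (intro conjI pbw_property_K3)

end
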